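(* Let $(X,r)$ be a finite bijective left non-degenerate solution of the Yang--Baxter equation. Let $M=M(X,r)$. If $K$ is a field and $P$ is a prime ideal of $K[M]$ such that $P\cap M\ne\varnothing$ then $$P\cap M=\bigcup_{Y\in\mathcal F}D_Y,$$ where $\mathcal F=\{Y\subseteq X:Y\ne\varnothing\text{ and }D_Y\cap P\ne\varnothing\}$. Moreover, if $Y\in\mathcal F$ and $Y\subseteq Z\subseteq X$ then $D_Z\subseteq P$.
   Context: Let $X$ be a non-empty set. A (set-theoretic) solution of the Yang--Baxter equation is a pair $(X,r)$ with $r\colon X\times X\to X\times X$, written $r(x,y)=(\lambda_x(y),\rho_y(x))$, such that $(r\times\mathrm{id})(\mathrm{id}\times r)(r\times\mathrm{id})=(\mathrm{id}\times r)(r\times\mathrm{id})(\mathrm{id}\times r)$. It is finite if $X$ is finite, bijective if $r$ is bijective, left non-degenerate if every $\lambda_x\colon X\to X$ is bijective. The structure monoid is $M=M(X,r)=\langle X\mid xy=\lambda_x(y)\rho_y(x)\text{ for all }x,y\in X\rangle$, and $K[M]$ is its monoid algebra. For a non-empty subset $Y\subseteq X$ let $M_Y=\bigcap_{y\in Y}yM$ (the elements of $M$ left divisible by all generators in $Y$) and $D_Y=M_Y\setminus\bigcup_{x\in X\setminus Y}xM$ (the elements of $M$ whose set of left divisors among the generators $X$ is exactly $Y$). *)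

theory Defs
  imports "HOL-Algebra.Coset" "HOL-Algebra.Ideal_Product"
begin

section \<open>Set-theoretic solutions of the Yang--Baxter equation\<close>

definition lam :: "('a \<times> 'a \<Rightarrow> 'a \<times> 'a) \<Rightarrow> 'a \<Rightarrow> 'a \<Rightarrow> 'a"
  where "lam r x y = fst (r (x, y))"

text \<open>The second index is the subscript: \<open>rho r y x\<close> is $\rho_y(x)$.\<close>

definition rho :: "('a \<times> 'a \<Rightarrow> 'a \<times> 'a) \<Rightarrow> 'a \<Rightarrow> 'a \<Rightarrow> 'a"
  where "rho r y x = snd (r (x, y))"

text \<open>
  Triple products associate to the right, so $\mathrm{id} \times r$ is
  \<open>map_prod id r\<close>, whereas $r \times \mathrm{id}$ needs re-bracketing.
\<close>

definition left_id :: "('a \<times> 'a \<Rightarrow> 'a \<times> 'a) \<Rightarrow> 'a \<times> 'a \<times> 'a \<Rightarrow> 'a \<times> 'a \<times> 'a"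
  where "left_id r = (\<lambda>(x, y, z). (lam r x y, rho r y x, z))"

definition id_right :: "('a \<times> 'a \<Rightarrow> 'a \<times> 'a) \<Rightarrow> 'a \<times> 'a \<times> 'a \<Rightarrow> 'a \<times> 'a \<times> 'a"
  where "id_right r = map_prod id r"

locale ybe_solution =
  fixes X :: "'a set" and r :: "'a \<times> 'a \<Rightarrow> 'a \<times> 'a"
  assumes nonempty: "X \<noteq> {}"
    and maps_to: "r \<in> X \<times> X \<rightarrow> X \<times> X"
    and yang_baxter: "t \<in> X \<times> X \<times> X \<Longrightarrow>
      left_id r (id_right r (left_id r t)) = id_right r (left_id r (id_right r t))"

definition bijective_on :: "'a set \<Rightarrow> ('a \<times> 'a \<Rightarrow> 'a \<times> 'a) \<Rightarrow> bool"
  where "bijective_on X r \<longleftrightarrow> bij_betw r (X \<times> X) (X \<times> X)"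

definition left_nondegenerate :: "'a set \<Rightarrow> ('a \<times> 'a \<Rightarrow> 'a \<times> 'a) \<Rightarrow> bool"
  where "left_nondegenerate X r \<longleftrightarrow> (\<forall>x\<in>X. bij_betw (lam r x) X X)"


section \<open>Monoid presentations\<close>

text \<open>
  The least monoid congruence on the free monoid \<open>lists X\<close> containing \<open>R\<close>.
\<close>

inductive_set presentation_cong :: "'a set \<Rightarrow> ('a list \<times> 'a list) set \<Rightarrow> ('a list \<times> 'a list) set"
  for X :: "'a set" and R :: "('a list \<times> 'a list) set"
  where
    cong_base: "\<lbrakk>(u, v) \<in> R; u \<in> lists X; v \<in> lists X\<rbrakk> \<Longrightarrow> (u, v) \<in> presentation_cong X R"
  | cong_refl: "u \<in> lists X \<Longrightarrow> (u, u) \<in> presentation_cong X R"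
  | cong_sym: "(u, v) \<in> presentation_cong X R \<Longrightarrow> (v, u) \<in> presentation_cong X R"
  | cong_trans: "\<lbrakk>(u, v) \<in> presentation_cong X R; (v, w) \<in> presentation_cong X R\<rbrakk>
      \<Longrightarrow> (u, w) \<in> presentation_cong X R"
  | cong_append: "\<lbrakk>(u, v) \<in> presentation_cong X R; (u', v') \<in> presentation_cong X R\<rbrakk>
      \<Longrightarrow> (u @ u', v @ v') \<in> presentation_cong X R"

definition word_class :: "'a set \<Rightarrow> ('a list \<times> 'a list) set \<Rightarrow> 'a list \<Rightarrow> 'a list set"
  where "word_class X R u = presentation_cong X R `` {u}"

definition presented_monoid :: "'a set \<Rightarrow> ('a list \<times> 'a list) set \<Rightarrow> 'a list set monoid"
  where "presented_monoid X R =
    \<lparr>carrier = lists X // presentation_cong X R,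
     mult = (\<lambda>A B. \<Union>u\<in>A. \<Union>v\<in>B. word_class X R (u @ v)),
     one = word_class X R []\<rparr>"

lemma presentation_cong_lists:
  "(u, v) \<in> presentation_cong X R \<Longrightarrow> u \<in> lists X \<and> v \<in> lists X"
  by (induction rule: presentation_cong.induct) auto

lemma equiv_presentation_cong: "equiv (lists X) (presentation_cong X R)"
proof (rule equivI)
  show "presentation_cong X R \<subseteq> lists X \<times> lists X"
    using presentation_cong_lists by fast
  show "refl_on (lists X) (presentation_cong X R)"
    by (auto intro: refl_onI presentation_cong.cong_refl)
  show "sym (presentation_cong X R)"
    by (auto intro: symI presentation_cong.cong_sym)
  show "trans (presentation_cong X R)"
    by (auto intro: transI presentation_cong.cong_trans)
qed

lemma word_class_eq_iff:
  "\<lbrakk>u \<in> lists X; v \<in> lists X\<rbrakk> \<Longrightarrow>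
    word_class X R u = word_class X R v \<longleftrightarrow> (u, v) \<in> presentation_cong X R"
  unfolding word_class_def by (rule eq_equiv_class_iff[OF equiv_presentation_cong])

lemma presented_monoid_carrier:
  "carrier (presented_monoid X R) = word_class X R ` lists X"
  by (auto simp: presented_monoid_def word_class_def quotient_def)

lemma presented_monoid_one: "\<one>\<^bsub>presented_monoid X R\<^esub> = word_class X R []"
  by (simp add: presented_monoid_def)

lemma UN_UN_const:
  assumes "A \<noteq> {}" "B \<noteq> {}" "\<And>u v. \<lbrakk>u \<in> A; v \<in> B\<rbrakk> \<Longrightarrow> f u v = C"
  shows "(\<Union>u\<in>A. \<Union>v\<in>B. f u v) = C"
proof -
  have "(\<Union>v\<in>B. f u v) = C" if "u \<in> A" for u
    using assms(2,3) that by simp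
  with assms(1) show ?thesis by simp
qed

lemma presented_monoid_mult:
  assumes "u \<in> lists X" "v \<in> lists X"
  shows "word_class X R u \<otimes>\<^bsub>presented_monoid X R\<^esub> word_class X R v = word_class X R (u @ v)"
proof -
  have eq: "word_class X R (u' @ v') = word_class X R (u @ v)"
    if "u' \<in> word_class X R u" "v' \<in> word_class X R v" for u' v'
  proof -
    have "(u, u') \<in> presentation_cong X R" "(v, v') \<in> presentation_cong X R"
      using that by (auto simp: word_class_def)
    then have "(u @ v, u' @ v') \<in> presentation_cong X R"
      by (rule presentation_cong.cong_append)
    then show ?thesis
      using word_class_eq_iff presentation_cong_lists by (metis (no_types))
  qed
  have "u \<in> word_class X R u" "v \<in> word_class X R v"
    using assms by (auto simp: word_class_def intro: presentation_cong.cong_refl)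
  then have "word_class X R u \<noteq> {}" "word_class X R v \<noteq> {}"
    by auto
  then have "(\<Union>u'\<in>word_class X R u. \<Union>v'\<in>word_class X R v. word_class X R (u' @ v')) =
      word_class X R (u @ v)"
    by (rule UN_UN_const[OF _ _ eq])
  then show ?thesis
    by (simp add: presented_monoid_def)
qed

lemma monoid_presented_monoid: "monoid (presented_monoid X R)"
proof (rule monoidI)
  fix a b assume "a \<in> carrier (presented_monoid X R)" "b \<in> carrier (presented_monoid X R)"
  then show "a \<otimes>\<^bsub>presented_monoid X R\<^esub> b \<in> carrier (presented_monoid X R)"
    unfolding presented_monoid_carrier
    by (elim imageE) (simp only: presented_monoid_mult append_in_lists_conv imageI)
next
  show "\<one>\<^bsub>presented_monoid X R\<^esub> \<in> carrier (presented_monoid X R)"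
    by (simp add: presented_monoid_carrier presented_monoid_one)
next
  fix a b c assume "a \<in> carrier (presented_monoid X R)" "b \<in> carrier (presented_monoid X R)"
    "c \<in> carrier (presented_monoid X R)"
  then obtain u v w where
    "u \<in> lists X" "v \<in> lists X" "w \<in> lists X"
    "a = word_class X R u" "b = word_class X R v" "c = word_class X R w"
    by (auto simp: presented_monoid_carrier)
  then show "a \<otimes>\<^bsub>presented_monoid X R\<^esub> b \<otimes>\<^bsub>presented_monoid X R\<^esub> c =
      a \<otimes>\<^bsub>presented_monoid X R\<^esub> (b \<otimes>\<^bsub>presented_monoid X R\<^esub> c)"
    by (simp add: presented_monoid_mult append_in_lists_conv)
next
  fix a assume "a \<in> carrier (presented_monoid X R)"
  then obtain u where u: "u \<in> lists X" "a = word_class X R u"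
    by (auto simp: presented_monoid_carrier)
  show "\<one>\<^bsub>presented_monoid X R\<^esub> \<otimes>\<^bsub>presented_monoid X R\<^esub> a = a"
    using u presented_monoid_mult[of "[]" X u R] by (simp add: presented_monoid_one)
  show "a \<otimes>\<^bsub>presented_monoid X R\<^esub> \<one>\<^bsub>presented_monoid X R\<^esub> = a"
    using u presented_monoid_mult[of u X "[]" R] by (simp add: presented_monoid_one)
qed


section \<open>The structure monoid of a solution\<close>

definition structure_relations ::
  "'a set \<Rightarrow> ('a \<times> 'a \<Rightarrow> 'a \<times> 'a) \<Rightarrow> ('a list \<times> 'a list) set"
  where "structure_relations X r = {([x, y], [lam r x y, rho r y x]) | x y. x \<in> X \<and> y \<in> X}"

definition structure_monoid :: "'a set \<Rightarrow> ('a \<times> 'a \<Rightarrow> 'a \<times> 'a) \<Rightarrow> 'a list set monoid"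
  where "structure_monoid X r = presented_monoid X (structure_relations X r)"

definition structure_gen :: "'a set \<Rightarrow> ('a \<times> 'a \<Rightarrow> 'a \<times> 'a) \<Rightarrow> 'a \<Rightarrow> 'a list set"
  where "structure_gen X r x = word_class X (structure_relations X r) [x]"

definition gen_multiples :: "'a set \<Rightarrow> ('a \<times> 'a \<Rightarrow> 'a \<times> 'a) \<Rightarrow> 'a \<Rightarrow> 'a list set set"
  where "gen_multiples X r x =
    structure_gen X r x <#\<^bsub>structure_monoid X r\<^esub> carrier (structure_monoid X r)"

text \<open>
  $M_Y$ and $D_Y$ are only meaningful for \<open>Y \<noteq> {}\<close>; the intersection over the
  empty set would be \<open>UNIV\<close> rather than the carrier.
\<close>

definition M_set :: "'a set \<Rightarrow> ('a \<times> 'a \<Rightarrow> 'a \<times> 'a) \<Rightarrow> 'a set \<Rightarrow> 'a list set set"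
  where "M_set X r Y = (\<Inter>y\<in>Y. gen_multiples X r y)"

definition D_set :: "'a set \<Rightarrow> ('a \<times> 'a \<Rightarrow> 'a \<times> 'a) \<Rightarrow> 'a set \<Rightarrow> 'a list set set"
  where "D_set X r Y = M_set X r Y - (\<Union>x\<in>X - Y. gen_multiples X r x)"


section \<open>Monoid algebras\<close>

text \<open>
  Elements are finitely supported coefficient functions, required to vanish
  outside \<open>carrier M\<close> so that equality of functions is equality in the algebra.
\<close>

definition msupp :: "('k, 'c) ring_scheme \<Rightarrow> ('m \<Rightarrow> 'k) \<Rightarrow> 'm set"
  where "msupp K f = {m. f m \<noteq> \<zero>\<^bsub>K\<^esub>}"

definition monoid_basis ::
  "('k, 'c) ring_scheme \<Rightarrow> 'm \<Rightarrow> ('m \<Rightarrow> 'k)"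
  where "monoid_basis K m = (\<lambda>n. if n = m then \<one>\<^bsub>K\<^esub> else \<zero>\<^bsub>K\<^esub>)"

definition monoid_algebra ::
  "('k, 'c) ring_scheme \<Rightarrow> ('m, 'd) monoid_scheme \<Rightarrow> ('m \<Rightarrow> 'k) ring"
  where "monoid_algebra K M =
    \<lparr>carrier = {f. range f \<subseteq> carrier K \<and> msupp K f \<subseteq> carrier M \<and> finite (msupp K f)},
     mult = (\<lambda>f g m. \<Oplus>\<^bsub>K\<^esub>p\<in>{p \<in> msupp K f \<times> msupp K g. fst p \<otimes>\<^bsub>M\<^esub> snd p = m}.
       f (fst p) \<otimes>\<^bsub>K\<^esub> g (snd p)),
     one = monoid_basis K \<one>\<^bsub>M\<^esub>,
     zero = (\<lambda>m. \<zero>\<^bsub>K\<^esub>),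
     add = (\<lambda>f g m. f m \<oplus>\<^bsub>K\<^esub> g m)\<rparr>"

lemma (in abelian_monoid) finsum_swap:
  assumes "finite A" "finite B" "\<And>a b. a \<in> A \<Longrightarrow> b \<in> B \<Longrightarrow> F a b \<in> carrier G"
  shows "(\<Oplus>a\<in>A. \<Oplus>b\<in>B. F a b) = (\<Oplus>b\<in>B. \<Oplus>a\<in>A. F a b)"
  using assms(1,3)
proof (induction A rule: finite_induct)
  case empty
  then show ?case by (simp add: finsum_zero)
next
  case (insert x A)
  have "(\<Oplus>a\<in>insert x A. \<Oplus>b\<in>B. F a b) = (\<Oplus>b\<in>B. F x b) \<oplus> (\<Oplus>a\<in>A. \<Oplus>b\<in>B. F a b)"
    using insert.hyps insert.prems by (intro finsum_insert) (auto intro!: finsum_closed)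
  also have "\<dots> = (\<Oplus>b\<in>B. F x b) \<oplus> (\<Oplus>b\<in>B. \<Oplus>a\<in>A. F a b)"
    using insert.IH insert.prems by simp
  also have "\<dots> = (\<Oplus>b\<in>B. F x b \<oplus> (\<Oplus>a\<in>A. F a b))"
    using insert.prems by (intro finsum_addf[symmetric]) (auto intro!: finsum_closed)
  also have "\<dots> = (\<Oplus>b\<in>B. \<Oplus>a\<in>insert x A. F a b)"
    using insert.hyps insert.prems
    by (intro finsum_cong' refl finsum_insert[symmetric]) (auto intro!: finsum_closed a_closed)
  finally show ?case .
qed

lemma (in abelian_monoid) finsum_cartesian:
  assumes "finite A" "finite B" "\<And>a b. a \<in> A \<Longrightarrow> b \<in> B \<Longrightarrow> F a b \<in> carrier G"
  shows "(\<Oplus>p\<in>A \<times> B. F (fst p) (snd p)) = (\<Oplus>a\<in>A. \<Oplus>b\<in>B. F a b)"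
  using assms(1,3)
proof (induction A rule: finite_induct)
  case empty
  then show ?case by simp
next
  case (insert x A)
  have "(\<Oplus>p\<in>insert x A \<times> B. F (fst p) (snd p)) = (\<Oplus>p\<in>(Pair x ` B) \<union> (A \<times> B). F (fst p) (snd p))"
    by (intro arg_cong2[of _ _ _ _ "finsum G"] refl) auto
  also have "\<dots> = (\<Oplus>p\<in>Pair x ` B. F (fst p) (snd p)) \<oplus> (\<Oplus>p\<in>A \<times> B. F (fst p) (snd p))"
    using insert.hyps insert.prems assms(2) by (intro finsum_Un_disjoint) auto
  also have "(\<Oplus>p\<in>Pair x ` B. F (fst p) (snd p)) = (\<Oplus>b\<in>B. F x b)"
    using insert.prems by (subst finsum_reindex) (auto simp: inj_on_def)
  also have "(\<Oplus>b\<in>B. F x b) \<oplus> (\<Oplus>p\<in>A \<times> B. F (fst p) (snd p)) = (\<Oplus>a\<in>insert x A. \<Oplus>b\<in>B. F a b)"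
    using insert.hyps insert.prems insert.IH
    by (subst finsum_insert) (auto intro!: finsum_closed)
  finally show ?case .
qed

locale monoid_algebra_ring = K: ring K + M: monoid M
  for K :: "('k, 'c) ring_scheme" (structure) and M :: "('m, 'd) monoid_scheme"
begin

abbreviation KM :: "('m \<Rightarrow> 'k) ring" where "KM \<equiv> monoid_algebra K M"

lemma carrier_iff:
  "f \<in> carrier KM \<longleftrightarrow> (\<forall>m. f m \<in> carrier K) \<and> msupp K f \<subseteq> carrier M \<and> finite (msupp K f)"
  by (auto simp: monoid_algebra_def)

lemma val [simp, intro]: "f \<in> carrier KM \<Longrightarrow> f m \<in> carrier K"
  by (simp add: carrier_iff)

lemma add_apply: "(f \<oplus>\<^bsub>KM\<^esub> g) m = f m \<oplus> g m"
  by (simp add: monoid_algebra_def)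

lemma zero_apply: "\<zero>\<^bsub>KM\<^esub> m = \<zero>"
  by (simp add: monoid_algebra_def)

lemma one_eq: "\<one>\<^bsub>KM\<^esub> = monoid_basis K \<one>\<^bsub>M\<^esub>"
  by (simp add: monoid_algebra_def)

lemma mult_apply:
  assumes f: "f \<in> carrier KM" and g: "g \<in> carrier KM"
    and A: "finite A" "msupp K f \<subseteq> A" and B: "finite B" "msupp K g \<subseteq> B"
  shows "(f \<otimes>\<^bsub>KM\<^esub> g) m = (\<Oplus>u\<in>A. \<Oplus>v\<in>B. if u \<otimes>\<^bsub>M\<^esub> v = m then f u \<otimes> g v else \<zero>)"
proof -
  let ?F = "\<lambda>u v. if u \<otimes>\<^bsub>M\<^esub> v = m then f u \<otimes> g v else \<zero>"
  have "(f \<otimes>\<^bsub>KM\<^esub> g) m = (\<Oplus>p\<in>{p \<in> msupp K f \<times> msupp K g. fst p \<otimes>\<^bsub>M\<^esub> snd p = m}. f (fst p) \<otimes> g (snd p))"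
    by (simp add: monoid_algebra_def)
  also have "\<dots> = (\<Oplus>p\<in>A \<times> B. ?F (fst p) (snd p))"
    using A B f g
    by (intro K.add.finprod_mono_neutral_cong_left) (auto simp: msupp_def)
  also have "\<dots> = (\<Oplus>u\<in>A. \<Oplus>v\<in>B. ?F u v)"
    using A B f g by (intro K.finsum_cartesian) auto
  finally show ?thesis .
qed

lemma mult_zero_outside:
  assumes f: "f \<in> carrier KM" and g: "g \<in> carrier KM"
    and "m \<notin> (\<lambda>p. fst p \<otimes>\<^bsub>M\<^esub> snd p) ` (msupp K f \<times> msupp K g)"
  shows "(f \<otimes>\<^bsub>KM\<^esub> g) m = \<zero>"
proof -
  have "{p \<in> msupp K f \<times> msupp K g. fst p \<otimes>\<^bsub>M\<^esub> snd p = m} = {}"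
    using assms(3) by blast
  then show ?thesis by (simp only: monoid_algebra_def ring.simps monoid.simps K.finsum_empty)
qed

lemma mult_closed:
  assumes f: "f \<in> carrier KM" and g: "g \<in> carrier KM"
  shows "f \<otimes>\<^bsub>KM\<^esub> g \<in> carrier KM"
proof -
  let ?W = "(\<lambda>p. fst p \<otimes>\<^bsub>M\<^esub> snd p) ` (msupp K f \<times> msupp K g)"
  have "msupp K (f \<otimes>\<^bsub>KM\<^esub> g) \<subseteq> ?W"
    using mult_zero_outside[OF f g] by (auto simp: msupp_def)
  moreover have "finite ?W" "?W \<subseteq> carrier M"
    using f g by (auto simp: carrier_iff intro!: M.m_closed)
  moreover have "(f \<otimes>\<^bsub>KM\<^esub> g) m \<in> carrier K" for m
    using f g by (auto simp: monoid_algebra_def intro!: K.finsum_closed)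
  ultimately show ?thesis
    by (simp add: carrier_iff) (meson finite_subset subset_trans)
qed

lemma mult_pairing:
  assumes f: "f \<in> carrier KM" and g: "g \<in> carrier KM" and \<phi>: "\<And>m. \<phi> m \<in> carrier K"
    and W: "finite W" "\<And>u v. u \<in> msupp K f \<Longrightarrow> v \<in> msupp K g \<Longrightarrow> u \<otimes>\<^bsub>M\<^esub> v \<in> W"
  shows "(\<Oplus>w\<in>W. (f \<otimes>\<^bsub>KM\<^esub> g) w \<otimes> \<phi> w) =
    (\<Oplus>u\<in>msupp K f. \<Oplus>v\<in>msupp K g. f u \<otimes> g v \<otimes> \<phi> (u \<otimes>\<^bsub>M\<^esub> v))"
proof -
  let ?A = "msupp K f" and ?B = "msupp K g"
  have fin: "finite ?A" "finite ?B" using f g by (auto simp: carrier_iff)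
  let ?t = "\<lambda>w u v. (if u \<otimes>\<^bsub>M\<^esub> v = w then f u \<otimes> g v else \<zero>) \<otimes> \<phi> w"
  have t: "?t w u v \<in> carrier K" for w u v using f g \<phi> by auto
  have "(\<Oplus>w\<in>W. (f \<otimes>\<^bsub>KM\<^esub> g) w \<otimes> \<phi> w) = (\<Oplus>w\<in>W. \<Oplus>u\<in>?A. \<Oplus>v\<in>?B. ?t w u v)"
  proof (intro K.finsum_cong' refl)
    fix w
    have "(f \<otimes>\<^bsub>KM\<^esub> g) w \<otimes> \<phi> w =
        (\<Oplus>u\<in>?A. \<Oplus>v\<in>?B. if u \<otimes>\<^bsub>M\<^esub> v = w then f u \<otimes> g v else \<zero>) \<otimes> \<phi> w"
      using mult_apply[OF f g fin(1) _ fin(2)] by simp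
    also have "\<dots> = (\<Oplus>u\<in>?A. (\<Oplus>v\<in>?B. if u \<otimes>\<^bsub>M\<^esub> v = w then f u \<otimes> g v else \<zero>) \<otimes> \<phi> w)"
      using fin f g \<phi> by (intro K.finsum_ldistr) (auto intro!: K.finsum_closed)
    also have "\<dots> = (\<Oplus>u\<in>?A. \<Oplus>v\<in>?B. ?t w u v)"
      using fin f g \<phi> by (intro K.finsum_cong' refl K.finsum_ldistr) (auto intro!: K.finsum_closed)
    finally show "(f \<otimes>\<^bsub>KM\<^esub> g) w \<otimes> \<phi> w = (\<Oplus>u\<in>?A. \<Oplus>v\<in>?B. ?t w u v)" .
  qed (use t in \<open>auto intro!: K.finsum_closed\<close>)
  also have "\<dots> = (\<Oplus>u\<in>?A. \<Oplus>w\<in>W. \<Oplus>v\<in>?B. ?t w u v)"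
    using W fin t by (intro K.finsum_swap) (auto intro!: K.finsum_closed)
  also have "\<dots> = (\<Oplus>u\<in>?A. \<Oplus>v\<in>?B. \<Oplus>w\<in>W. ?t w u v)"
    using W fin t by (intro K.finsum_cong' refl K.finsum_swap) (auto intro!: K.finsum_closed)
  also have "\<dots> = (\<Oplus>u\<in>?A. \<Oplus>v\<in>?B. f u \<otimes> g v \<otimes> \<phi> (u \<otimes>\<^bsub>M\<^esub> v))"
  proof (intro K.finsum_cong' refl)
    fix u v assume uv: "u \<in> ?A" "v \<in> ?B"
    have "(\<Oplus>w\<in>W. ?t w u v) = (\<Oplus>w\<in>W. if u \<otimes>\<^bsub>M\<^esub> v = w then f u \<otimes> g v \<otimes> \<phi> w else \<zero>)"
      using f g \<phi> by (intro K.finsum_cong' refl) auto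
    also have "\<dots> = f u \<otimes> g v \<otimes> \<phi> (u \<otimes>\<^bsub>M\<^esub> v)"
      using W(2)[OF uv] W(1) f g \<phi> by (intro K.finsum_singleton) auto
    finally show "(\<Oplus>w\<in>W. ?t w u v) = f u \<otimes> g v \<otimes> \<phi> (u \<otimes>\<^bsub>M\<^esub> v)" .
  qed (use f g \<phi> in \<open>auto intro!: K.finsum_closed\<close>)
  finally show ?thesis .
qed

lemma msupp_mult:
  assumes "f \<in> carrier KM" "g \<in> carrier KM"
  shows "msupp K (f \<otimes>\<^bsub>KM\<^esub> g) \<subseteq> (\<lambda>p. fst p \<otimes>\<^bsub>M\<^esub> snd p) ` (msupp K f \<times> msupp K g)"
  using mult_zero_outside[OF assms] by (auto simp: msupp_def)

lemma mult_assoc: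
  assumes f: "f \<in> carrier KM" and g: "g \<in> carrier KM" and h: "h \<in> carrier KM"
  shows "f \<otimes>\<^bsub>KM\<^esub> g \<otimes>\<^bsub>KM\<^esub> h = f \<otimes>\<^bsub>KM\<^esub> (g \<otimes>\<^bsub>KM\<^esub> h)"
proof
  fix m
  let ?A = "msupp K f" and ?B = "msupp K g" and ?C = "msupp K h"
  let ?AB = "(\<lambda>p. fst p \<otimes>\<^bsub>M\<^esub> snd p) ` (?A \<times> ?B)"
  let ?BC = "(\<lambda>p. fst p \<otimes>\<^bsub>M\<^esub> snd p) ` (?B \<times> ?C)"
  have fin: "finite ?A" "finite ?B" "finite ?C"
    and sub: "?A \<subseteq> carrier M" "?B \<subseteq> carrier M" "?C \<subseteq> carrier M"
    using f g h by (auto simp: carrier_iff)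
  have fg: "f \<otimes>\<^bsub>KM\<^esub> g \<in> carrier KM" and gh: "g \<otimes>\<^bsub>KM\<^esub> h \<in> carrier KM"
    using f g h mult_closed by auto
  have AB: "u \<otimes>\<^bsub>M\<^esub> v \<in> ?AB" if "u \<in> ?A" "v \<in> ?B" for u v
    using that by (intro image_eqI[of _ _ "(u, v)"]) auto
  have BC: "u \<otimes>\<^bsub>M\<^esub> v \<in> ?BC" if "u \<in> ?B" "v \<in> ?C" for u v
    using that by (intro image_eqI[of _ _ "(u, v)"]) auto
  let ?\<phi> = "\<lambda>w. \<Oplus>z\<in>?C. if w \<otimes>\<^bsub>M\<^esub> z = m then h z else \<zero>"
  let ?S = "\<Oplus>u\<in>?A. \<Oplus>v\<in>?B. \<Oplus>z\<in>?C.
    if u \<otimes>\<^bsub>M\<^esub> v \<otimes>\<^bsub>M\<^esub> z = m then f u \<otimes> g v \<otimes> h z else \<zero>"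
  have "(f \<otimes>\<^bsub>KM\<^esub> g \<otimes>\<^bsub>KM\<^esub> h) m =
      (\<Oplus>w\<in>?AB. \<Oplus>z\<in>?C. if w \<otimes>\<^bsub>M\<^esub> z = m then (f \<otimes>\<^bsub>KM\<^esub> g) w \<otimes> h z else \<zero>)"
    using fin msupp_mult[OF f g] by (intro mult_apply fg h) auto
  also have "\<dots> = (\<Oplus>w\<in>?AB. (f \<otimes>\<^bsub>KM\<^esub> g) w \<otimes> ?\<phi> w)"
  proof (intro K.finsum_cong' refl)
    fix w
    have "(f \<otimes>\<^bsub>KM\<^esub> g) w \<otimes> ?\<phi> w =
        (\<Oplus>z\<in>?C. (f \<otimes>\<^bsub>KM\<^esub> g) w \<otimes> (if w \<otimes>\<^bsub>M\<^esub> z = m then h z else \<zero>))"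
      using fin fg h by (intro K.finsum_rdistr) auto
    also have "\<dots> = (\<Oplus>z\<in>?C. if w \<otimes>\<^bsub>M\<^esub> z = m then (f \<otimes>\<^bsub>KM\<^esub> g) w \<otimes> h z else \<zero>)"
      using fg h by (intro K.finsum_cong' refl) auto
    finally show "(\<Oplus>z\<in>?C. if w \<otimes>\<^bsub>M\<^esub> z = m then (f \<otimes>\<^bsub>KM\<^esub> g) w \<otimes> h z else \<zero>) =
        (f \<otimes>\<^bsub>KM\<^esub> g) w \<otimes> ?\<phi> w" by simp
  qed (use fg h in \<open>auto intro!: K.finsum_closed\<close>)
  also have "\<dots> = (\<Oplus>u\<in>?A. \<Oplus>v\<in>?B. f u \<otimes> g v \<otimes> ?\<phi> (u \<otimes>\<^bsub>M\<^esub> v))"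
    using fin h by (intro mult_pairing f g) (auto intro!: K.finsum_closed AB )
  also have "\<dots> = ?S"
  proof (intro K.finsum_cong' refl)
    fix u v
    have "f u \<otimes> g v \<otimes> ?\<phi> (u \<otimes>\<^bsub>M\<^esub> v) =
        (\<Oplus>z\<in>?C. f u \<otimes> g v \<otimes> (if u \<otimes>\<^bsub>M\<^esub> v \<otimes>\<^bsub>M\<^esub> z = m then h z else \<zero>))"
      using fin f g h by (intro K.finsum_rdistr) auto
    also have "\<dots> = (\<Oplus>z\<in>?C. if u \<otimes>\<^bsub>M\<^esub> v \<otimes>\<^bsub>M\<^esub> z = m then f u \<otimes> g v \<otimes> h z else \<zero>)"
      using f g h by (intro K.finsum_cong' refl) auto
    finally show "f u \<otimes> g v \<otimes> ?\<phi> (u \<otimes>\<^bsub>M\<^esub> v) = \<dots>" .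
  qed (use f g h in \<open>auto intro!: K.finsum_closed\<close>)
  finally have l: "(f \<otimes>\<^bsub>KM\<^esub> g \<otimes>\<^bsub>KM\<^esub> h) m = ?S" .
  have "(f \<otimes>\<^bsub>KM\<^esub> (g \<otimes>\<^bsub>KM\<^esub> h)) m =
      (\<Oplus>u\<in>?A. \<Oplus>w\<in>?BC. if u \<otimes>\<^bsub>M\<^esub> w = m then f u \<otimes> (g \<otimes>\<^bsub>KM\<^esub> h) w else \<zero>)"
    using fin msupp_mult[OF g h] by (intro mult_apply f gh) auto
  also have "\<dots> = ?S"
  proof (rule K.finsum_cong'[OF refl])
    fix u assume u: "u \<in> ?A"
    let ?\<psi> = "\<lambda>w. if u \<otimes>\<^bsub>M\<^esub> w = m then \<one> else \<zero>"
    have "(\<Oplus>w\<in>?BC. if u \<otimes>\<^bsub>M\<^esub> w = m then f u \<otimes> (g \<otimes>\<^bsub>KM\<^esub> h) w else \<zero>) =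
        (\<Oplus>w\<in>?BC. f u \<otimes> ((g \<otimes>\<^bsub>KM\<^esub> h) w \<otimes> ?\<psi> w))"
      using f gh by (intro K.finsum_cong' refl) auto
    also have "\<dots> = f u \<otimes> (\<Oplus>w\<in>?BC. (g \<otimes>\<^bsub>KM\<^esub> h) w \<otimes> ?\<psi> w)"
      using fin f gh by (intro K.finsum_rdistr[symmetric]) auto
    also have "(\<Oplus>w\<in>?BC. (g \<otimes>\<^bsub>KM\<^esub> h) w \<otimes> ?\<psi> w) =
        (\<Oplus>v\<in>?B. \<Oplus>z\<in>?C. g v \<otimes> h z \<otimes> ?\<psi> (v \<otimes>\<^bsub>M\<^esub> z))"
      using fin by (intro mult_pairing g h) (auto intro!: BC)
    also have "f u \<otimes> \<dots> = (\<Oplus>v\<in>?B. f u \<otimes> (\<Oplus>z\<in>?C. g v \<otimes> h z \<otimes> ?\<psi> (v \<otimes>\<^bsub>M\<^esub> z)))"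
      using fin f g h by (intro K.finsum_rdistr) (auto intro!: K.finsum_closed)
    also have "\<dots> = (\<Oplus>v\<in>?B. \<Oplus>z\<in>?C. f u \<otimes> (g v \<otimes> h z \<otimes> ?\<psi> (v \<otimes>\<^bsub>M\<^esub> z)))"
      using fin f g h by (intro K.finsum_cong' refl K.finsum_rdistr) (auto intro!: K.finsum_closed)
    also have "\<dots> = (\<Oplus>v\<in>?B. \<Oplus>z\<in>?C.
        if u \<otimes>\<^bsub>M\<^esub> v \<otimes>\<^bsub>M\<^esub> z = m then f u \<otimes> g v \<otimes> h z else \<zero>)"
    proof (intro K.finsum_cong' refl)
      fix v z assume "v \<in> ?B" "z \<in> ?C"
      then have "u \<otimes>\<^bsub>M\<^esub> v \<otimes>\<^bsub>M\<^esub> z = u \<otimes>\<^bsub>M\<^esub> (v \<otimes>\<^bsub>M\<^esub> z)"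
        using u sub by (intro M.m_assoc) auto
      then show "f u \<otimes> (g v \<otimes> h z \<otimes> ?\<psi> (v \<otimes>\<^bsub>M\<^esub> z)) =
          (if u \<otimes>\<^bsub>M\<^esub> v \<otimes>\<^bsub>M\<^esub> z = m then f u \<otimes> g v \<otimes> h z else \<zero>)"
        using f g h by (simp add: K.m_assoc)
    qed (use f g h in \<open>auto intro!: K.finsum_closed\<close>)
    finally show "(\<Oplus>w\<in>?BC. if u \<otimes>\<^bsub>M\<^esub> w = m then f u \<otimes> (g \<otimes>\<^bsub>KM\<^esub> h) w else \<zero>) = \<dots>" .
  qed (use f g h in \<open>auto intro!: K.finsum_closed\<close>)
  finally show "(f \<otimes>\<^bsub>KM\<^esub> g \<otimes>\<^bsub>KM\<^esub> h) m = (f \<otimes>\<^bsub>KM\<^esub> (g \<otimes>\<^bsub>KM\<^esub> h)) m"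
    using l by simp
qed

lemma monoid_basis_closed: "m \<in> carrier M \<Longrightarrow> monoid_basis K m \<in> carrier KM"
  by (auto simp: carrier_iff monoid_basis_def msupp_def intro: finite_subset[of _ "{m}"])

lemma add_closed:
  assumes f: "f \<in> carrier KM" and g: "g \<in> carrier KM"
  shows "f \<oplus>\<^bsub>KM\<^esub> g \<in> carrier KM" "msupp K (f \<oplus>\<^bsub>KM\<^esub> g) \<subseteq> msupp K f \<union> msupp K g"
proof -
  show s: "msupp K (f \<oplus>\<^bsub>KM\<^esub> g) \<subseteq> msupp K f \<union> msupp K g"
    using f g by (auto simp: msupp_def add_apply)
  then show "f \<oplus>\<^bsub>KM\<^esub> g \<in> carrier KM"
    using f g by (simp add: carrier_iff add_apply) (meson finite_UnI finite_subset le_sup_iff subset_trans)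
qed

lemma ring_monoid_algebra: "ring KM"
proof (rule ringI)
  show "abelian_group KM"
  proof (rule abelian_groupI)
    fix f assume f: "f \<in> carrier KM"
    let ?g = "\<lambda>m. \<ominus> f m"
    have "msupp K ?g = msupp K f"
      using f by (auto simp: msupp_def)
    then have "?g \<in> carrier KM" using f by (simp add: carrier_iff)
    moreover have "?g \<oplus>\<^bsub>KM\<^esub> f = \<zero>\<^bsub>KM\<^esub>"
      using f by (auto simp: fun_eq_iff add_apply zero_apply K.l_neg)
    ultimately show "\<exists>g\<in>carrier KM. g \<oplus>\<^bsub>KM\<^esub> f = \<zero>\<^bsub>KM\<^esub>" by blast
  qed (auto simp: fun_eq_iff add_apply zero_apply K.a_ac add_closed,
       auto simp: carrier_iff zero_apply msupp_def)
next
  show "monoid KM"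
  proof (rule monoidI)
    fix f assume f: "f \<in> carrier KM"
    have fin: "finite (msupp K f)" and sub: "msupp K f \<subseteq> carrier M"
      using f by (auto simp: carrier_iff)
    have one: "\<one>\<^bsub>KM\<^esub> \<in> carrier KM" "msupp K \<one>\<^bsub>KM\<^esub> \<subseteq> {\<one>\<^bsub>M\<^esub>}"
      by (simp add: one_eq monoid_basis_closed, auto simp: one_eq msupp_def monoid_basis_def)
    have pick: "(\<Oplus>v\<in>msupp K f. if v = m then f v else \<zero>) = f m" for m
    proof (cases "m \<in> msupp K f")
      case True
      then show ?thesis
        using K.finsum_singleton[OF True fin, of f] f by (auto simp: eq_commute)
    next
      case False
      then have "(\<Oplus>v\<in>msupp K f. if v = m then f v else \<zero>) = (\<Oplus>v\<in>msupp K f. \<zero>)"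
        by (intro K.finsum_cong' refl) auto
      then show ?thesis using False by (simp add: msupp_def)
    qed
    show "\<one>\<^bsub>KM\<^esub> \<otimes>\<^bsub>KM\<^esub> f = f"
    proof
      fix m
      have "(\<one>\<^bsub>KM\<^esub> \<otimes>\<^bsub>KM\<^esub> f) m = (\<Oplus>u\<in>{\<one>\<^bsub>M\<^esub>}. \<Oplus>v\<in>msupp K f.
          if u \<otimes>\<^bsub>M\<^esub> v = m then \<one>\<^bsub>KM\<^esub> u \<otimes> f v else \<zero>)"
        using one fin by (intro mult_apply f) auto
      also have "\<dots> = (\<Oplus>v\<in>msupp K f. if \<one>\<^bsub>M\<^esub> \<otimes>\<^bsub>M\<^esub> v = m then \<one>\<^bsub>KM\<^esub> \<one>\<^bsub>M\<^esub> \<otimes> f v else \<zero>)"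
        using one(1) f by (subst K.finsum_insert) (auto intro!: K.finsum_closed)
      also have "\<dots> = (\<Oplus>v\<in>msupp K f. if v = m then f v else \<zero>)"
        using sub f by (intro K.finsum_cong' refl) (auto simp: one_eq monoid_basis_def)
      finally show "(\<one>\<^bsub>KM\<^esub> \<otimes>\<^bsub>KM\<^esub> f) m = f m" by (simp add: pick)
    qed
    show "f \<otimes>\<^bsub>KM\<^esub> \<one>\<^bsub>KM\<^esub> = f"
    proof
      fix m
      have "(f \<otimes>\<^bsub>KM\<^esub> \<one>\<^bsub>KM\<^esub>) m = (\<Oplus>u\<in>msupp K f. \<Oplus>v\<in>{\<one>\<^bsub>M\<^esub>}.
          if u \<otimes>\<^bsub>M\<^esub> v = m then f u \<otimes> \<one>\<^bsub>KM\<^esub> v else \<zero>)"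
        using one fin by (intro mult_apply f) auto
      also have "\<dots> = (\<Oplus>v\<in>msupp K f. if v = m then f v else \<zero>)"
        using sub f by (intro K.finsum_cong' refl) (auto simp: one_eq monoid_basis_def)
      finally show "(f \<otimes>\<^bsub>KM\<^esub> \<one>\<^bsub>KM\<^esub>) m = f m" by (simp add: pick)
    qed
  qed (simp_all add: mult_closed mult_assoc one_eq monoid_basis_closed)
next
  fix f g h assume f: "f \<in> carrier KM" and g: "g \<in> carrier KM" and h: "h \<in> carrier KM"
  let ?A = "msupp K f \<union> msupp K g" and ?C = "msupp K h"
  have fin: "finite ?A" "finite ?C" using f g h by (auto simp: carrier_iff)
  show "(f \<oplus>\<^bsub>KM\<^esub> g) \<otimes>\<^bsub>KM\<^esub> h = f \<otimes>\<^bsub>KM\<^esub> h \<oplus>\<^bsub>KM\<^esub> g \<otimes>\<^bsub>KM\<^esub> h"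
  proof
    fix m
    let ?t = "\<lambda>f u v. if u \<otimes>\<^bsub>M\<^esub> v = m then f u \<otimes> h v else \<zero>"
    have "((f \<oplus>\<^bsub>KM\<^esub> g) \<otimes>\<^bsub>KM\<^esub> h) m = (\<Oplus>u\<in>?A. \<Oplus>v\<in>?C. ?t (f \<oplus>\<^bsub>KM\<^esub> g) u v)"
      using fin f g h add_closed[OF f g] by (intro mult_apply) auto
    also have "\<dots> = (\<Oplus>u\<in>?A. (\<Oplus>v\<in>?C. ?t f u v) \<oplus> (\<Oplus>v\<in>?C. ?t g u v))"
    proof (rule K.finsum_cong'[OF refl])
      fix u
      have "(\<Oplus>v\<in>?C. ?t (f \<oplus>\<^bsub>KM\<^esub> g) u v) = (\<Oplus>v\<in>?C. ?t f u v \<oplus> ?t g u v)"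
        using f g h by (intro K.finsum_cong' refl) (auto simp: add_apply K.l_distr)
      also have "\<dots> = (\<Oplus>v\<in>?C. ?t f u v) \<oplus> (\<Oplus>v\<in>?C. ?t g u v)"
        using f g h by (intro K.finsum_addf) auto
      finally show "(\<Oplus>v\<in>?C. ?t (f \<oplus>\<^bsub>KM\<^esub> g) u v) =
          (\<Oplus>v\<in>?C. ?t f u v) \<oplus> (\<Oplus>v\<in>?C. ?t g u v)" .
    qed (use f g h in \<open>auto intro!: K.finsum_closed\<close>)
    also have "\<dots> = (\<Oplus>u\<in>?A. \<Oplus>v\<in>?C. ?t f u v) \<oplus> (\<Oplus>u\<in>?A. \<Oplus>v\<in>?C. ?t g u v)"
      using f g h by (intro K.finsum_addf) (auto intro!: K.finsum_closed)
    also have "(\<Oplus>u\<in>?A. \<Oplus>v\<in>?C. ?t f u v) = (f \<otimes>\<^bsub>KM\<^esub> h) m"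
      using fin f h by (intro mult_apply[symmetric]) auto
    also have "(\<Oplus>u\<in>?A. \<Oplus>v\<in>?C. ?t g u v) = (g \<otimes>\<^bsub>KM\<^esub> h) m"
      using fin g h by (intro mult_apply[symmetric]) auto
    finally show "((f \<oplus>\<^bsub>KM\<^esub> g) \<otimes>\<^bsub>KM\<^esub> h) m = (f \<otimes>\<^bsub>KM\<^esub> h \<oplus>\<^bsub>KM\<^esub> g \<otimes>\<^bsub>KM\<^esub> h) m"
      by (simp only: add_apply[of "f \<otimes>\<^bsub>KM\<^esub> h" "g \<otimes>\<^bsub>KM\<^esub> h" m])
  qed
  show "h \<otimes>\<^bsub>KM\<^esub> (f \<oplus>\<^bsub>KM\<^esub> g) = h \<otimes>\<^bsub>KM\<^esub> f \<oplus>\<^bsub>KM\<^esub> h \<otimes>\<^bsub>KM\<^esub> g"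
  proof
    fix m
    let ?t = "\<lambda>f u v. if u \<otimes>\<^bsub>M\<^esub> v = m then h u \<otimes> f v else \<zero>"
    have "(h \<otimes>\<^bsub>KM\<^esub> (f \<oplus>\<^bsub>KM\<^esub> g)) m = (\<Oplus>u\<in>?C. \<Oplus>v\<in>?A. ?t (f \<oplus>\<^bsub>KM\<^esub> g) u v)"
      using fin f g h add_closed[OF f g] by (intro mult_apply) auto
    also have "\<dots> = (\<Oplus>u\<in>?C. (\<Oplus>v\<in>?A. ?t f u v) \<oplus> (\<Oplus>v\<in>?A. ?t g u v))"
    proof (rule K.finsum_cong'[OF refl])
      fix u
      have "(\<Oplus>v\<in>?A. ?t (f \<oplus>\<^bsub>KM\<^esub> g) u v) = (\<Oplus>v\<in>?A. ?t f u v \<oplus> ?t g u v)"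
        using f g h by (intro K.finsum_cong' refl) (auto simp: add_apply K.r_distr)
      also have "\<dots> = (\<Oplus>v\<in>?A. ?t f u v) \<oplus> (\<Oplus>v\<in>?A. ?t g u v)"
        using f g h by (intro K.finsum_addf) auto
      finally show "(\<Oplus>v\<in>?A. ?t (f \<oplus>\<^bsub>KM\<^esub> g) u v) =
          (\<Oplus>v\<in>?A. ?t f u v) \<oplus> (\<Oplus>v\<in>?A. ?t g u v)" .
    qed (use f g h in \<open>auto intro!: K.finsum_closed\<close>)
    also have "\<dots> = (\<Oplus>u\<in>?C. \<Oplus>v\<in>?A. ?t f u v) \<oplus> (\<Oplus>u\<in>?C. \<Oplus>v\<in>?A. ?t g u v)"
      using f g h by (intro K.finsum_addf) (auto intro!: K.finsum_closed)
    also have "(\<Oplus>u\<in>?C. \<Oplus>v\<in>?A. ?t f u v) = (h \<otimes>\<^bsub>KM\<^esub> f) m"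
      using fin f h by (intro mult_apply[symmetric]) auto
    also have "(\<Oplus>u\<in>?C. \<Oplus>v\<in>?A. ?t g u v) = (h \<otimes>\<^bsub>KM\<^esub> g) m"
      using fin g h by (intro mult_apply[symmetric]) auto
    finally show "(h \<otimes>\<^bsub>KM\<^esub> (f \<oplus>\<^bsub>KM\<^esub> g)) m = (h \<otimes>\<^bsub>KM\<^esub> f \<oplus>\<^bsub>KM\<^esub> h \<otimes>\<^bsub>KM\<^esub> g) m"
      by (simp only: add_apply[of "h \<otimes>\<^bsub>KM\<^esub> f" "h \<otimes>\<^bsub>KM\<^esub> g" m])
  qed
qed

lemma monoid_basis_mult:
  assumes "m \<in> carrier M" "n \<in> carrier M"
  shows "monoid_basis K m \<otimes>\<^bsub>KM\<^esub> monoid_basis K n = monoid_basis K (m \<otimes>\<^bsub>M\<^esub> n)"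
proof
  fix k
  have "(monoid_basis K m \<otimes>\<^bsub>KM\<^esub> monoid_basis K n) k = (\<Oplus>u\<in>{m}. \<Oplus>v\<in>{n}.
      if u \<otimes>\<^bsub>M\<^esub> v = k then monoid_basis K m u \<otimes> monoid_basis K n v else \<zero>)"
    using assms by (intro mult_apply monoid_basis_closed) (auto simp: msupp_def monoid_basis_def)
  then show "(monoid_basis K m \<otimes>\<^bsub>KM\<^esub> monoid_basis K n) k = monoid_basis K (m \<otimes>\<^bsub>M\<^esub> n) k"
    by (auto simp: monoid_basis_def)
qed

end


section \<open>Prime ideals of noncommutative rings\<close>

text \<open>
  The library's \<open>primeideal\<close> presupposes a commutative ring and is elementwise. Here \<open>ideal\<close> means two-sided ideal and \<open>\<cdot>\<close> is the ideal product.
\<close>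

locale prime_ideal = ideal P R for P and R (structure) +
  assumes proper: "P \<noteq> carrier R"
    and prime: "\<lbrakk>ideal I R; ideal J R; I \<cdot> J \<subseteq> P\<rbrakk> \<Longrightarrow> I \<subseteq> P \<or> J \<subseteq> P"

end

theory Submission
  imports Defs "HOL-Library.Infinite_Set"
begin

text \<open>
  The maps \<open>\<lambda>\<^sub>x\<close> extend to an action of $M$ on $X$, and a letter can be moved to the front of a word
  at the price of acting on it, $v y = \lambda_v(y) v'$. So if $a = x_1 \cdots x_m$, then every
  $\lambda_{x_1 \cdots x_j}(x_{j+1})$ is a left divisor of $a$, hence of every $b$ whose left divisors
  include those of $a$. If such a $b$ were outside $P$, primeness would give an infinite sequence
  $p_{i+1} = p_i b c_i$ outside $P$, along which $\lambda_{p_i}$ takes one value infinitely often.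
  Between two such indices the action is trivial, so the letters $x_1, \dots, x_m$ can be collected
  one after the other from the successive factors $b$; eventually some $p_i$ lies in $p_k a M$. Hence
  $a \notin P$.
\<close>

section \<open>Words over a solution\<close>

context ybe_solution
begin

abbreviation word_eq :: "'a list \<Rightarrow> 'a list \<Rightarrow> bool" (infix "\<simeq>" 50)
  where "u \<simeq> v \<equiv> (u, v) \<in> presentation_cong X (structure_relations X r)"

abbreviation word_action :: "'a list \<Rightarrow> 'a \<Rightarrow> 'a"
  where "word_action \<equiv> foldr (lam r)"

lemma lam_closed: "x \<in> X \<Longrightarrow> y \<in> X \<Longrightarrow> lam r x y \<in> X"
  and rho_closed: "x \<in> X \<Longrightarrow> y \<in> X \<Longrightarrow> rho r y x \<in> X"
  using maps_to by (auto simp: lam_def rho_def Pi_iff mem_Times_iff)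

text \<open>This is the first coordinate of the Yang--Baxter equation at \<open>(x, y, z)\<close>.
  It makes \<lambda> compatible with the defining relations of M.\<close>

lemma lam_lam:
  assumes "x \<in> X" "y \<in> X" "z \<in> X"
  shows "lam r (lam r x y) (lam r (rho r y x) z) = lam r x (lam r y z)"
proof -
  have "left_id r (id_right r (left_id r (x, y, z))) = id_right r (left_id r (id_right r (x, y, z)))"
    using assms by (intro yang_baxter) auto
  then show ?thesis
    by (auto simp: left_id_def id_right_def lam_def rho_def split: prod.splits)
qed

lemma word_action_closed: "w \<in> lists X \<Longrightarrow> z \<in> X \<Longrightarrow> word_action w z \<in> X"
  by (induction w) (auto intro: lam_closed)

text \<open>The action of words descends to M: on a defining relation this is
  \<open>lam_lam\<close>, and concatenation of words acts by composition.\<close>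

lemma word_eq_action: "u \<simeq> v \<Longrightarrow> z \<in> X \<Longrightarrow> word_action u z = word_action v z"
proof (induction arbitrary: z rule: presentation_cong.induct)
  case (cong_base u v)
  then show ?case by (auto simp: structure_relations_def lam_lam)
next
  case (cong_append u v u' v')
  then show ?case
    using word_action_closed[of v' z] presentation_cong_lists[of u' v'] by auto
qed auto

lemma word_eq_refl: "w \<in> lists X \<Longrightarrow> w \<simeq> w"
  by (rule presentation_cong.cong_refl)

lemma word_eq_append_left: "u \<simeq> v \<Longrightarrow> w \<in> lists X \<Longrightarrow> w @ u \<simeq> w @ v"
  by (intro presentation_cong.cong_append word_eq_refl)

lemma word_eq_append_right: "u \<simeq> v \<Longrightarrow> w \<in> lists X \<Longrightarrow> u @ w \<simeq> v @ w"
  by (intro presentation_cong.cong_append word_eq_refl)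

text \<open>By induction the letter first passes through the tail \<open>v\<close>, arriving as
  \<open>word_action v y\<close>; one application of a defining relation then carries it past
  \<open>x\<close>.\<close>

lemma word_move_front:
  assumes "v \<in> lists X" "y \<in> X"
  shows "\<exists>v'\<in>lists X. v @ [y] \<simeq> word_action v y # v'"
  using assms(1)
proof (induction v)
  case Nil
  then show ?case using assms(2) by (auto intro!: bexI[of _ "[]"] word_eq_refl)
next
  case (Cons x v)
  then obtain v' where v': "v' \<in> lists X" "v @ [y] \<simeq> word_action v y # v'" by auto
  let ?z = "word_action v y"
  have z: "?z \<in> X" and x: "x \<in> X" using Cons assms(2) word_action_closed by auto
  have "(x # v) @ [y] \<simeq> x # ?z # v'"
    using word_eq_append_left[OF v'(2), of "[x]"] x by simp
  moreover have "[x, ?z] \<simeq> [lam r x ?z, rho r ?z x]"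
    using x z by (intro presentation_cong.cong_base)
      (auto simp: structure_relations_def intro: lam_closed rho_closed)
  then have "x # ?z # v' \<simeq> lam r x ?z # rho r ?z x # v'"
    using word_eq_append_right[OF _ v'(1)] by fastforce
  ultimately have "(x # v) @ [y] \<simeq> word_action (x # v) y # rho r ?z x # v'"
    using presentation_cong.cong_trans by fastforce
  then show ?case using v'(1) rho_closed[OF x z] by (metis lists.Cons)
qed

section \<open>Generators dividing a word on the left\<close>

definition left_divisors :: "'a list \<Rightarrow> 'a set"
  where "left_divisors w = {y \<in> X. \<exists>w'\<in>lists X. w \<simeq> y # w'}"

text \<open>The letter at position \<open>j\<close> is moved to the front across the prefix
  \<open>take j w\<close>, which acts on it; the letters after position \<open>j\<close> stay in
  place.\<close>

lemma word_action_nth_left_divisor: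
  assumes "w \<in> lists X" "j < length w"
  shows "word_action (take j w) (w ! j) \<in> left_divisors w"
proof -
  have t: "take j w \<in> lists X" and d: "drop (Suc j) w \<in> lists X" and x: "w ! j \<in> X"
    using assms by (auto dest: in_set_takeD in_set_dropD)
  obtain v' where v': "v' \<in> lists X"
    "take j w @ [w ! j] \<simeq> word_action (take j w) (w ! j) # v'"
    using word_move_front[OF t x] by blast
  have "w \<simeq> word_action (take j w) (w ! j) # v' @ drop (Suc j) w"
    using word_eq_append_right[OF v'(2) d] id_take_nth_drop[OF assms(2)] by simp
  then show ?thesis
    using v'(1) d word_action_closed[OF t x] unfolding left_divisors_def
    by (intro CollectI conjI bexI[of _ "v' @ drop (Suc j) w"]) auto
qed

lemma left_divisors_nonempty:
  assumes "w \<in> lists X" "w \<noteq> []"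
  shows "left_divisors w \<noteq> {}"
  using word_action_nth_left_divisor[of w 0] assms by auto

lemma word_action_inj_on:
  assumes "left_nondegenerate X r" "w \<in> lists X"
  shows "inj_on (word_action w) X"
  using assms(2)
proof (induction w)
  case (Cons x w)
  then have "inj_on (lam r x) X" "inj_on (word_action w) X" "word_action w ` X \<subseteq> X"
    using assms(1) word_action_closed[of w] by (auto simp: left_nondegenerate_def bij_betw_def)
  then have "inj_on (lam r x \<circ> word_action w) X"
    by (meson comp_inj_on inj_on_subset)
  then show ?case by (simp add: comp_def)
qed auto

end


section \<open>Prime ideals of words\<close>

text \<open>\<open>Q\<close> stands for the words whose class lies in P. The last assumption is the
  contrapositive of elementwise primeness, tested on words only, so the combinatorial argument can
  avoid K[M].\<close>

locale word_prime = ybe_solution +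
  fixes Q :: "'a list set"
  assumes Q_cong: "u \<simeq> v \<Longrightarrow> u \<in> Q \<Longrightarrow> v \<in> Q"
    and Q_ideal: "a \<in> Q \<Longrightarrow> u \<in> lists X \<Longrightarrow> v \<in> lists X \<Longrightarrow> u @ a @ v \<in> Q"
    and Q_prime: "u \<in> lists X \<Longrightarrow> v \<in> lists X \<Longrightarrow> u \<notin> Q \<Longrightarrow> v \<notin> Q \<Longrightarrow>
      \<exists>c\<in>lists X. u @ c @ v \<notin> Q"
begin

lemma escaping_sequence:
  assumes b: "b \<in> lists X" "b \<notin> Q"
  shows "\<exists>p :: nat \<Rightarrow> 'a list. \<forall>i. p i \<in> lists X \<and> p i \<notin> Q \<and>
    (\<forall>j>i. \<exists>d\<in>lists X. p j = p i @ b @ d)"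
proof -
  \<comment> \<open>The invariant kept is \<open>p i @ b \<notin> Q\<close>, stronger than
    \<open>p i \<notin> Q\<close>, because primeness is applied to the pair \<open>p i @ b\<close>
    and \<open>b\<close>.\<close>
  have "\<exists>p. \<forall>i. (p i \<in> lists X \<and> p i @ b \<notin> Q) \<and> (\<exists>c\<in>lists X. p (Suc i) = p i @ b @ c)"
  proof (rule dependent_nat_choice)
    show "\<exists>p. p \<in> lists X \<and> p @ b \<notin> Q" using b by (intro exI[of _ "[]"]) auto
  next
    fix p :: "'a list" and n :: nat
    assume p: "p \<in> lists X \<and> p @ b \<notin> Q"
    then obtain c where "c \<in> lists X" "(p @ b) @ c @ b \<notin> Q"
      using Q_prime[of "p @ b" b] b by auto
    then show "\<exists>q. (q \<in> lists X \<and> q @ b \<notin> Q) \<and> (\<exists>c\<in>lists X. q = p @ b @ c)"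
      using p b by (intro exI[of _ "p @ b @ c"]) auto
  qed
  then obtain p where
    "\<forall>i. (p i \<in> lists X \<and> p i @ b \<notin> Q) \<and> (\<exists>c\<in>lists X. p (Suc i) = p i @ b @ c)" ..
  then have p: "\<And>i. p i \<in> lists X" "\<And>i. p i @ b \<notin> Q"
    and step: "\<And>i. \<exists>c\<in>lists X. p (Suc i) = p i @ b @ c" by auto
  have "p i \<notin> Q" for i
    using Q_ideal[of "p i" "[]" b] p b by auto
  moreover have "\<exists>d\<in>lists X. p j = p i @ b @ d" if "i < j" for i j
    using that
  proof (induction j)
    case (Suc j)
    obtain c where c: "c \<in> lists X" "p (Suc j) = p j @ b @ c" using step by blast
    show ?case
    proof (cases "i = j")
      case False
      then obtain d where "d \<in> lists X" "p j = p i @ b @ d" using Suc by auto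
      then show ?thesis using c b by (intro bexI[of _ "d @ b @ c"]) auto
    qed (use c in auto)
  qed simp
  ultimately show ?thesis using p(1) by (intro exI[of _ p]) auto
qed

text \<open>Both claims of the theorem rest on this: membership in \<open>Q\<close> depends only on
  the set of left divisors, and passes to words with more of them.\<close>

lemma left_divisors_mono:
  assumes fin: "finite X" and nd: "left_nondegenerate X r"
    and a: "a \<in> Q" "a \<in> lists X" and b: "b \<in> lists X"
    and sub: "left_divisors a \<subseteq> left_divisors b"
  shows "b \<in> Q"
proof (rule ccontr)
  assume "b \<notin> Q"
  then obtain p :: "nat \<Rightarrow> 'a list" where
    "\<forall>i. p i \<in> lists X \<and> p i \<notin> Q \<and> (\<forall>j>i. \<exists>d\<in>lists X. p j = p i @ b @ d)"
    using escaping_sequence[OF b] by blast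
  then have p: "\<And>i. p i \<in> lists X" "\<And>i. p i \<notin> Q"
    and later: "\<And>i j. i < j \<Longrightarrow> \<exists>d\<in>lists X. p j = p i @ b @ d"
    by auto
  \<comment> \<open>Restricting to \<open>X\<close> turns equality of the actions on
    \<open>X\<close> into equality of functions, of which there are only finitely many.\<close>
  define act where "act i = restrict (word_action (p i)) X" for i
  have "range act \<subseteq> X \<rightarrow>\<^sub>E X"
    using word_action_closed p(1) by (auto simp: act_def)
  then have "finite (range act)"
    using finite_PiE[OF fin, of "\<lambda>_. X"] fin finite_subset by blast
  then obtain k where S: "infinite {i. act i = act k}"
    using pigeonhole_infinite[OF infinite_UNIV_nat] by auto
  have pk: "p k \<in> lists X" by (rule p)
  have inj_pk: "inj_on (word_action (p k)) X"
    by (rule word_action_inj_on[OF nd pk])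
  \<comment> \<open>The first \<open>j\<close> letters of \<open>a\<close> have been collected right
    behind \<open>p k\<close>, with a leftover \<open>v\<close>. Keeping
    \<open>act i = act k\<close> forces \<open>take j a @ v\<close> to act trivially on
    \<open>X\<close>.\<close>
  have "\<exists>i v. act i = act k \<and> v \<in> lists X \<and> p i \<simeq> p k @ take j a @ v" if "j \<le> length a" for j
    using that
  proof (induction j)
    case 0
    then show ?case
      using word_eq_refl[OF pk] by (intro exI[of _ k] exI[of _ "[]"]) auto
  next
    case (Suc j)
    then obtain i v where i: "act i = act k" and v: "v \<in> lists X"
      and pi: "p i \<simeq> p k @ take j a @ v" by auto
    have j: "j < length a" using Suc by simp
    define t where "t = take j a"
    define x where "x = a ! j"
    \<comment> \<open>This is the left divisor of \<open>a\<close> obtained by moving its next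
      letter \<open>x\<close> to the front; it is what \<open>b\<close> can supply.\<close>
    define y where "y = word_action t x"
    have t: "t \<in> lists X" and x: "x \<in> X"
      using a(2) j by (auto simp: t_def x_def dest: in_set_takeD)
    have y: "y \<in> X" unfolding y_def by (rule word_action_closed[OF t x])
    \<comment> \<open>\<open>p i\<close> and \<open>p k @ t @ v\<close> act alike, and so do
      \<open>p i\<close> and \<open>p k\<close>; the injective action of \<open>p k\<close>
      cancels.\<close>
    have triv: "word_action t (word_action v y) = y"
    proof (rule inj_onD[OF inj_pk])
      have "word_action (p i) y = word_action (p k) y"
        using i y by (metis act_def restrict_apply')
      then show "word_action (p k) (word_action t (word_action v y)) = word_action (p k) y"
        using word_eq_action[OF pi y] by (simp add: t_def)
    qed (use y v t in \<open>auto intro!: word_action_closed\<close>)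
    \<comment> \<open>Both \<open>word_action v y\<close> and \<open>x\<close> are sent to
      \<open>y\<close> by the injective action of \<open>t\<close>. Hence \<open>y\<close> turns
      into exactly the required letter \<open>x\<close> when it crosses \<open>v\<close>.\<close>
    have vy: "word_action v y = x"
      using inj_onD[OF word_action_inj_on[OF nd t]] triv[unfolded y_def]
        word_action_closed[OF v y] x
      by (simp add: y_def)
    have "y \<in> left_divisors b"
      using word_action_nth_left_divisor[OF a(2) j] sub by (auto simp: y_def t_def x_def)
    then obtain b' where b': "b' \<in> lists X" "b \<simeq> y # b'" by (auto simp: left_divisors_def)
    obtain v' where v': "v' \<in> lists X" "v @ [y] \<simeq> x # v'"
      using word_move_front[OF v y] vy by auto
    \<comment> \<open>A later index with the same action makes a fresh factor \<open>b\<close>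
      available behind \<open>p i\<close> and preserves the invariant.\<close>
    obtain i' where i': "i < i'" "act i' = act k"
      using S infinite_nat_iff_unbounded[of "{i. act i = act k}"] by auto
    obtain d where d: "d \<in> lists X" "p i' = p i @ b @ d" using later[OF i'(1)] by blast
    have "p i @ b @ d \<simeq> (p k @ t @ v) @ (y # b') @ d"
      unfolding t_def by (intro presentation_cong.cong_append pi b' word_eq_refl d)
    \<comment> \<open>The letter \<open>y\<close> split off from \<open>b\<close> crosses the
      leftover \<open>v\<close>, arrives as \<open>x\<close> and extends the prefix
      \<open>t\<close>.\<close>
    moreover have "(p k @ t) @ (v @ [y]) @ b' @ d \<simeq> (p k @ t) @ (x # v') @ b' @ d"
      using pk t b'(1) d(1) by (intro presentation_cong.cong_append v' word_eq_refl) auto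
    ultimately have "p i' \<simeq> p k @ (t @ [x]) @ v' @ b' @ d"
      using d(2) presentation_cong.cong_trans by fastforce
    moreover have "t @ [x] = take (Suc j) a"
      using j by (simp add: t_def x_def take_Suc_conv_app_nth)
    ultimately show ?case using i'(2) v'(1) b'(1) d(1)
      by (intro exI[of _ i'] exI[of _ "v' @ b' @ d"]) auto
  qed
  from this[of "length a"] obtain i v where v: "v \<in> lists X" and pi: "p i \<simeq> p k @ a @ v"
    by auto
  have "p i \<in> Q"
    using Q_cong[OF presentation_cong.cong_sym[OF pi]] Q_ideal[OF a(1) pk v] by blast
  then show False
    using p(2) by blast
qed

end


section \<open>Prime ideals of the monoid algebra\<close>

text \<open>
  The ideals $I = \{f : fRv \subseteq P\}$ and $J = \{g : IRg \subseteq P\}$ contain $u$ and $v$ and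
  satisfy $IJ \subseteq P$; they are easier to handle than the ideals generated by $u$ and $v$.
\<close>

lemma (in prime_ideal) prime_elementwise:
  assumes u: "u \<in> carrier R" and v: "v \<in> carrier R"
    and uv: "\<And>h. h \<in> carrier R \<Longrightarrow> u \<otimes> h \<otimes> v \<in> P"
  shows "u \<in> P \<or> v \<in> P"
proof -
  define I where "I = {f \<in> carrier R. \<forall>h\<in>carrier R. f \<otimes> h \<otimes> v \<in> P}"
  define J where "J = {g \<in> carrier R. \<forall>f\<in>I. \<forall>h\<in>carrier R. f \<otimes> h \<otimes> g \<in> P}"
  have I: "ideal I R"
  proof (rule idealI[OF ring_axioms])
    show "subgroup I (add_monoid R)"
    proof (rule add.subgroupI)
      fix f g assume "f \<in> I" "g \<in> I"
      then show "f \<oplus> g \<in> I" using v by (auto simp: I_def l_distr)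
    next
      fix f assume "f \<in> I"
      then show "\<ominus> f \<in> I" using v by (auto simp: I_def l_minus)
    qed (use v in \<open>auto simp: I_def intro!: exI[of _ "\<zero>"]\<close>)
  next
    fix f x assume f: "f \<in> I" and x: "x \<in> carrier R"
    then show "x \<otimes> f \<in> I" using v by (auto simp: I_def m_assoc I_l_closed)
    have "f \<otimes> x \<otimes> h \<otimes> v \<in> P" if "h \<in> carrier R" for h
    proof -
      have "f \<otimes> (x \<otimes> h) \<otimes> v \<in> P" using f x that by (auto simp: I_def)
      then show ?thesis using f x that by (simp add: I_def m_assoc)
    qed
    then show "f \<otimes> x \<in> I" using f x by (auto simp: I_def)
  qed
  have Ic: "f \<in> carrier R" if "f \<in> I" for f using that by (simp add: I_def)
  have J: "ideal J R"
  proof (rule idealI[OF ring_axioms])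
    show "subgroup J (add_monoid R)"
    proof (rule add.subgroupI)
      fix f g assume "f \<in> J" "g \<in> J"
      then show "f \<oplus> g \<in> J" by (auto simp: J_def r_distr Ic)
    next
      fix f assume "f \<in> J"
      then show "\<ominus> f \<in> J" by (auto simp: J_def r_minus Ic)
    qed (auto simp: J_def Ic intro!: exI[of _ "\<zero>"])
  next
    fix g x assume g: "g \<in> J" and x: "x \<in> carrier R"
    have "f \<otimes> h \<otimes> (x \<otimes> g) \<in> P" if "f \<in> I" "h \<in> carrier R" for f h
    proof -
      have "f \<otimes> (h \<otimes> x) \<otimes> g \<in> P" using g x that by (auto simp: J_def)
      then show ?thesis using g x that Ic by (simp add: J_def m_assoc)
    qed
    then show "x \<otimes> g \<in> J" using g x by (auto simp: J_def)
    have "f \<otimes> h \<otimes> (g \<otimes> x) \<in> P" if "f \<in> I" "h \<in> carrier R" for f h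
    proof -
      have "f \<otimes> h \<otimes> g \<otimes> x \<in> P" using g x that by (auto simp: J_def I_r_closed)
      then show ?thesis using g x that Ic by (simp add: J_def m_assoc)
    qed
    then show "g \<otimes> x \<in> J" using g x by (auto simp: J_def)
  qed
  have "s \<in> P" if "s \<in> I \<cdot> J" for s
    using that
  proof (induction rule: ideal_prod.induct)
    \<comment> \<open>The definition of \<open>J\<close> is used with the middle factor equal to
      one.\<close>
    case (prod f g)
    then have "f \<otimes> \<one> \<otimes> g \<in> P" by (auto simp: J_def)
    then show ?case using prod Ic by simp
  qed simp
  then have "I \<subseteq> P \<or> J \<subseteq> P"
    using prime[OF I J] by blast
  \<comment> \<open>The hypothesis on \<open>u\<close> and \<open>v\<close> puts \<open>u\<close> in
    \<open>I\<close>, while \<open>v \<in> J\<close> just restates the condition defining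
    \<open>I\<close>.\<close>
  moreover have "u \<in> I" "v \<in> J" using u v uv by (auto simp: I_def J_def)
  ultimately show ?thesis by blast
qed

section \<open>Monomials, and primeness tested on basis elements\<close>

context monoid_algebra_ring
begin

definition monomial :: "'k \<Rightarrow> 'm \<Rightarrow> ('m \<Rightarrow> 'k)"
  where "monomial k m = (\<lambda>n. if n = m then k else \<zero>)"

lemma monomial_closed: "k \<in> carrier K \<Longrightarrow> m \<in> carrier M \<Longrightarrow> monomial k m \<in> carrier KM"
  by (auto simp: carrier_iff monomial_def msupp_def intro: finite_subset[of _ "{m}"])

lemma monomial_mult:
  assumes "k \<in> carrier K" "l \<in> carrier K" "m \<in> carrier M" "n \<in> carrier M"
  shows "monomial k m \<otimes>\<^bsub>KM\<^esub> monomial l n = monomial (k \<otimes> l) (m \<otimes>\<^bsub>M\<^esub> n)"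
proof
  fix s
  have "(monomial k m \<otimes>\<^bsub>KM\<^esub> monomial l n) s = (\<Oplus>u\<in>{m}. \<Oplus>v\<in>{n}.
      if u \<otimes>\<^bsub>M\<^esub> v = s then monomial k m u \<otimes> monomial l n v else \<zero>)"
    using assms by (intro mult_apply monomial_closed) (auto simp: msupp_def monomial_def)
  then show "(monomial k m \<otimes>\<^bsub>KM\<^esub> monomial l n) s = monomial (k \<otimes> l) (m \<otimes>\<^bsub>M\<^esub> n) s"
    using assms by (auto simp: monomial_def)
qed

lemma monomial_one: "monomial \<one> m = monoid_basis K m"
  by (simp add: monomial_def monoid_basis_def)

lemma monoid_algebra_induct [consumes 1, case_names zero add]:
  assumes h: "h \<in> carrier KM"
    and zero: "Q \<zero>\<^bsub>KM\<^esub>"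
    and add: "\<And>f k m. f \<in> carrier KM \<Longrightarrow> Q f \<Longrightarrow> k \<in> carrier K \<Longrightarrow> m \<in> carrier M \<Longrightarrow>
      Q (f \<oplus>\<^bsub>KM\<^esub> monomial k m)"
  shows "Q h"
proof -
  have "finite (msupp K h)" using h by (simp add: carrier_iff)
  \<comment> \<open>The claim is generalised to all elements supported inside \<open>A\<close>, so
    that the induction hypothesis covers an element from which one term has been deleted.\<close>
  then have "\<forall>h\<in>carrier KM. msupp K h \<subseteq> A \<longrightarrow> Q h" if "A = msupp K h" for A
    unfolding that[symmetric]
  proof (induction A rule: finite_induct)
    case empty
    have "f = \<zero>\<^bsub>KM\<^esub>" if "msupp K f \<subseteq> {}" for f
      using that by (auto simp: fun_eq_iff zero_apply msupp_def)
    then show ?case using zero by auto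
  next
    case (insert m A)
    show ?case
    proof (intro ballI impI)
      fix f assume f: "f \<in> carrier KM" and sub: "msupp K f \<subseteq> insert m A"
      show "Q f"
      proof (cases "m \<in> msupp K f")
        case True
        let ?g = "f(m := \<zero>)"
        have m: "m \<in> carrier M" using True f by (auto simp: carrier_iff)
        have supp: "msupp K ?g = msupp K f - {m}" by (auto simp: msupp_def)
        then have g: "?g \<in> carrier KM" using f by (auto simp: carrier_iff)
        have "Q ?g" using insert.IH g sub supp by auto
        then have "Q (?g \<oplus>\<^bsub>KM\<^esub> monomial (f m) m)" using g f m by (intro add) auto
        moreover have "?g \<oplus>\<^bsub>KM\<^esub> monomial (f m) m = f"
          using f by (auto simp: fun_eq_iff add_apply monomial_def)
        ultimately show ?thesis by simp
      next
        case False
        then show ?thesis using insert.IH f sub by blast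
      qed
    qed
  qed
  then show ?thesis using h by blast
qed

text \<open>The elements h for which u h v lies in P are closed under addition and contain all
  monomials, so the test on elements of M suffices for \<open>prime_elementwise\<close>.\<close>

lemma prime_ideal_basis:
  assumes P: "prime_ideal P KM" and u: "u \<in> carrier M" and v: "v \<in> carrier M"
    and uv: "\<And>c. c \<in> carrier M \<Longrightarrow> monoid_basis K (u \<otimes>\<^bsub>M\<^esub> c \<otimes>\<^bsub>M\<^esub> v) \<in> P"
  shows "monoid_basis K u \<in> P \<or> monoid_basis K v \<in> P"
proof -
  interpret P: prime_ideal P KM by (rule P)
  have uc: "monoid_basis K u \<in> carrier KM" and vc: "monoid_basis K v \<in> carrier KM"
    using u v by (auto intro: monoid_basis_closed)
  have "monoid_basis K u \<otimes>\<^bsub>KM\<^esub> h \<otimes>\<^bsub>KM\<^esub> monoid_basis K v \<in> P" if "h \<in> carrier KM" for h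
    using that
  proof (induction rule: monoid_algebra_induct)
    case zero
    then show ?case using uc vc by simp
  next
    case (add f k m)
    \<comment> \<open>The coefficient \<open>k\<close> is pulled out to the left as a monomial at
      the unit, where the ideal property absorbs it.\<close>
    have "monoid_basis K u \<otimes>\<^bsub>KM\<^esub> monomial k m \<otimes>\<^bsub>KM\<^esub> monoid_basis K v =
        monomial k \<one>\<^bsub>M\<^esub> \<otimes>\<^bsub>KM\<^esub> monoid_basis K (u \<otimes>\<^bsub>M\<^esub> m \<otimes>\<^bsub>M\<^esub> v)"
      using add u v by (simp add: monomial_mult flip: monomial_one)
    moreover have "monomial k \<one>\<^bsub>M\<^esub> \<otimes>\<^bsub>KM\<^esub> monoid_basis K (u \<otimes>\<^bsub>M\<^esub> m \<otimes>\<^bsub>M\<^esub> v) \<in> P"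
      using add uv by (intro P.I_l_closed monomial_closed) auto
    ultimately show ?case
      using add uc vc monomial_closed[of k m] by (simp add: P.l_distr P.r_distr)
  qed
  then show ?thesis by (rule P.prime_elementwise[OF uc vc])
qed

end


section \<open>Divisibility in the structure monoid\<close>

context ybe_solution
begin

abbreviation cls :: "'a list \<Rightarrow> 'a list set"
  where "cls \<equiv> word_class X (structure_relations X r)"

lemma carrier_structure_monoid: "carrier (structure_monoid X r) = cls ` lists X"
  by (simp add: structure_monoid_def presented_monoid_carrier)

lemma structure_monoid_mult:
  "u \<in> lists X \<Longrightarrow> v \<in> lists X \<Longrightarrow> cls u \<otimes>\<^bsub>structure_monoid X r\<^esub> cls v = cls (u @ v)"
  by (simp add: structure_monoid_def presented_monoid_mult)

lemma gen_multiples_eq: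
  assumes y: "y \<in> X"
  shows "gen_multiples X r y = {cls w | w. w \<in> lists X \<and> y \<in> left_divisors w}"
proof -
  have "gen_multiples X r y = (\<lambda>w'. cls (y # w')) ` lists X"
    using y structure_monoid_mult[of "[y]"]
    by (auto simp: gen_multiples_def l_coset_def carrier_structure_monoid structure_gen_def)
  also have "\<dots> = {cls w | w. w \<in> lists X \<and> y \<in> left_divisors w}"
  proof (intro equalityI subsetI)
    fix m assume "m \<in> (\<lambda>w'. cls (y # w')) ` lists X"
    then obtain w' where w': "w' \<in> lists X" "m = cls (y # w')" by (rule imageE)
    then have "y # w' \<in> lists X" "y \<in> left_divisors (y # w')"
      using y unfolding left_divisors_def
      by (auto simp del: in_lists_conv_set intro!: bexI[of _ w'] word_eq_refl)
    then show "m \<in> {cls w | w. w \<in> lists X \<and> y \<in> left_divisors w}"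
      using w'(2) by blast
  next
    fix m assume "m \<in> {cls w | w. w \<in> lists X \<and> y \<in> left_divisors w}"
    then obtain w w' where "m = cls w" "w \<in> lists X" "w' \<in> lists X" "w \<simeq> y # w'"
      unfolding left_divisors_def by blast
    moreover from this have "cls w = cls (y # w')"
      using presentation_cong_lists by (subst word_class_eq_iff) blast+
    ultimately show "m \<in> (\<lambda>w'. cls (y # w')) ` lists X" by blast
  qed
  finally show ?thesis .
qed

text \<open>\<open>gen_multiples_eq\<close> only provides some representative divisible by
  \<open>y\<close>; transitivity of the congruence transfers divisibility to the given one.\<close>

lemma gen_multiples_iff:
  assumes "w \<in> lists X" "y \<in> X"
  shows "cls w \<in> gen_multiples X r y \<longleftrightarrow> y \<in> left_divisors w"
proof -
  have "y \<in> left_divisors w" if "w' \<in> lists X" "y \<in> left_divisors w'" "cls w = cls w'" for w'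
  proof -
    have "w \<simeq> w'" using that assms(1) by (simp only: word_class_eq_iff)
    then show ?thesis
      using that(2) unfolding left_divisors_def by (blast intro: presentation_cong.cong_trans)
  qed
  then show ?thesis using assms by (auto simp: gen_multiples_eq simp del: in_lists_conv_set)
qed

lemma D_set_eq:
  assumes "Y \<subseteq> X" "Y \<noteq> {}"
  shows "D_set X r Y = {cls w | w. w \<in> lists X \<and> left_divisors w = Y}"
proof -
  have "gen_multiples X r y \<subseteq> cls ` lists X" if "y \<in> X" for y
    using that by (auto simp: gen_multiples_eq simp del: in_lists_conv_set)
  \<comment> \<open>Here \<open>Y\<close> must be nonempty: an empty intersection would not be
    confined to the carrier.\<close>
  then have car: "D_set X r Y \<subseteq> cls ` lists X"
    using assms by (auto simp: D_set_def M_set_def)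
  have iff: "cls w \<in> D_set X r Y \<longleftrightarrow> left_divisors w = Y" if "w \<in> lists X" for w
  proof -
    have "cls w \<in> D_set X r Y \<longleftrightarrow> (\<forall>y\<in>Y. y \<in> left_divisors w) \<and> (\<forall>x\<in>X - Y. x \<notin> left_divisors w)"
      using gen_multiples_iff[OF that] assms(1) by (auto simp: D_set_def M_set_def)
    then show ?thesis by (auto simp: left_divisors_def)
  qed
  show ?thesis
  proof (intro equalityI subsetI)
    fix m assume m: "m \<in> D_set X r Y"
    then obtain w where "w \<in> lists X" "m = cls w" using car by blast
    with m iff show "m \<in> {cls w | w. w \<in> lists X \<and> left_divisors w = Y}" by blast
  qed (use iff in blast)
qed

text \<open>Concatenation of words corresponds to multiplication of basis elements in K[M], so the
  ideal property carries over directly and primeness comes from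
  \<open>prime_ideal_basis\<close>.\<close>

lemma word_prime_of_prime_ideal:
  assumes "ring K" and P: "prime_ideal P (monoid_algebra K (structure_monoid X r))"
  defines "Q \<equiv> {w \<in> lists X. monoid_basis K (cls w) \<in> P}"
  shows "word_prime X r Q"
proof -
  let ?M = "structure_monoid X r"
  interpret monoid_algebra_ring K ?M
    using assms(1) monoid_presented_monoid
    by (simp add: monoid_algebra_ring_def structure_monoid_def)
  interpret P: prime_ideal P KM by (rule P)
  have car: "cls w \<in> carrier ?M" if "w \<in> lists X" for w
    using that by (simp add: carrier_structure_monoid)
  show ?thesis
  proof unfold_locales
    fix u v assume "u \<simeq> v" "u \<in> Q"
    then show "v \<in> Q"
      using presentation_cong_lists[of u v X "structure_relations X r"]
        word_class_eq_iff[of u X v "structure_relations X r"]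
      by (simp add: Q_def del: in_lists_conv_set)
  next
    fix a u v assume a: "a \<in> Q" and u: "u \<in> lists X" and v: "v \<in> lists X"
    have "monoid_basis K (cls u) \<otimes>\<^bsub>KM\<^esub> (monoid_basis K (cls a) \<otimes>\<^bsub>KM\<^esub> monoid_basis K (cls v)) \<in> P"
      using a u v by (intro P.I_l_closed P.I_r_closed) (auto simp: Q_def intro!: monoid_basis_closed car)
    then show "u @ a @ v \<in> Q"
      using a u v by (simp add: Q_def monoid_basis_mult car structure_monoid_mult)
  next
    fix u v assume u: "u \<in> lists X" "u \<notin> Q" and v: "v \<in> lists X" "v \<notin> Q"
    show "\<exists>c\<in>lists X. u @ c @ v \<notin> Q"
    proof (rule ccontr)
      assume "\<not> ?thesis"
      then have uv: "monoid_basis K (cls (u @ c @ v)) \<in> P" if "c \<in> lists X" for c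
        using that by (simp add: Q_def)
      have "monoid_basis K (cls u \<otimes>\<^bsub>?M\<^esub> c \<otimes>\<^bsub>?M\<^esub> cls v) \<in> P" if "c \<in> carrier ?M" for c
      proof -
        obtain w where "w \<in> lists X" "c = cls w"
          using \<open>c \<in> carrier ?M\<close> unfolding carrier_structure_monoid by (rule imageE)
        then show ?thesis using uv u(1) v(1) by (simp add: structure_monoid_mult)
      qed
      then show False
        using prime_ideal_basis[OF P car[OF u(1)] car[OF v(1)]] u v by (auto simp: Q_def)
    qed
  qed
qed

end

text \<open>Elements of M are identified with their images under \<open>monoid_basis K\<close>, so
  subsets of M are compared with P inside K[M].\<close>

theorem proposition6p4:
  fixes X :: "'a set" and r :: "'a \<times> 'a \<Rightarrow> 'a \<times> 'a"
    and K :: "('k, 'c) ring_scheme" and P :: "('a list set \<Rightarrow> 'k) set"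
  defines "M \<equiv> structure_monoid X r"
  defines "\<F> \<equiv> {Y. Y \<subseteq> X \<and> Y \<noteq> {} \<and> monoid_basis K ` D_set X r Y \<inter> P \<noteq> {}}"
  assumes "ybe_solution X r" and "finite X" and "bijective_on X r" and "left_nondegenerate X r"
    and "field K" and "prime_ideal P (monoid_algebra K M)"
    and "P \<inter> monoid_basis K ` carrier M \<noteq> {}"
  shows "P \<inter> monoid_basis K ` carrier M = (\<Union>Y\<in>\<F>. monoid_basis K ` D_set X r Y) \<and>
    (\<forall>Y\<in>\<F>. \<forall>Z. Y \<subseteq> Z \<and> Z \<subseteq> X \<longrightarrow> monoid_basis K ` D_set X r Z \<subseteq> P)"
proof -
  interpret ybe_solution X r by fact
  interpret K: field K by fact
  interpret P: prime_ideal P "monoid_algebra K M" by fact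
  define Q where "Q = {w \<in> lists X. monoid_basis K (cls w) \<in> P}"
  interpret word_prime X r Q
    unfolding Q_def using assms(8) K.ring_axioms
    by (intro word_prime_of_prime_ideal) (auto simp: M_def)
  have up: "monoid_basis K ` D_set X r Z \<subseteq> P" if Y: "Y \<in> \<F>" and Z: "Y \<subseteq> Z" "Z \<subseteq> X" for Y Z
  proof -
    have "D_set X r Y = {cls w | w. w \<in> lists X \<and> left_divisors w = Y}"
      using Y by (intro D_set_eq) (auto simp: \<F>_def)
    then obtain a where a: "a \<in> Q" "left_divisors a = Y"
      using Y by (auto simp: \<F>_def Q_def)
    have "b \<in> Q" if "b \<in> lists X" "left_divisors b = Z" for b
      using left_divisors_mono[OF assms(4,6) a(1)] a that Z(1) by (simp add: Q_def)
    moreover have "D_set X r Z = {cls w | w. w \<in> lists X \<and> left_divisors w = Z}"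
      using Y Z by (intro D_set_eq) (auto simp: \<F>_def)
    ultimately show ?thesis by (auto simp: Q_def)
  qed
  \<comment> \<open>The empty word represents the identity of K[M], which a proper ideal does not
    contain.\<close>
  have "[] \<notin> Q"
    using P.one_imp_carrier P.proper
    by (auto simp: Q_def M_def monoid_algebra_def structure_monoid_def presented_monoid_one)
  \<comment> \<open>For the inclusion from left to right, \<open>Y\<close> is the set of left
    divisors of a word representing the element; it is nonempty because the word is.\<close>
  have "\<exists>Y\<in>\<F>. f \<in> monoid_basis K ` D_set X r Y" if f: "f \<in> P" "f \<in> monoid_basis K ` carrier M" for f
  proof -
    obtain w where w: "w \<in> lists X" "f = monoid_basis K (cls w)"
      using f by (auto simp: M_def carrier_structure_monoid)
    with f \<open>[] \<notin> Q\<close> have "w \<noteq> []" by (auto simp: Q_def)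
    then have "left_divisors w \<noteq> {}" using left_divisors_nonempty w by blast
    moreover have "left_divisors w \<subseteq> X" by (auto simp: left_divisors_def)
    moreover from calculation have "cls w \<in> D_set X r (left_divisors w)"
      using w(1) D_set_eq by blast
    ultimately have "f \<in> monoid_basis K ` D_set X r (left_divisors w)" "left_divisors w \<in> \<F>"
      using w(2) f(1) by (auto simp: \<F>_def)
    then show ?thesis by blast
  qed
  moreover have "f \<in> P \<inter> monoid_basis K ` carrier M"
    if "Y \<in> \<F>" "f \<in> monoid_basis K ` D_set X r Y" for Y f
  proof -
    have Y: "Y \<subseteq> X" "Y \<noteq> {}" using that(1) by (auto simp: \<F>_def)
    then have "D_set X r Y \<subseteq> carrier M"
      unfolding D_set_eq[OF Y] M_def carrier_structure_monoid by blast
    with that(2) have "f \<in> monoid_basis K ` carrier M" by (meson image_mono subsetD)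
    \<comment> \<open>The reverse inclusion is the upward closure \<open>up\<close> with
      \<open>Z = Y\<close>.\<close>
    moreover have "f \<in> P" by (rule subsetD[OF up[OF that(1) subset_refl Y(1)] that(2)])
    ultimately show ?thesis by (rule IntI[rotated])
  qed
  ultimately have "P \<inter> monoid_basis K ` carrier M = (\<Union>Y\<in>\<F>. monoid_basis K ` D_set X r Y)"
    by (intro equalityI subsetI) (simp_all only: UN_iff Int_iff, blast+)
  then show ?thesis by (intro conjI ballI allI impI up) auto
qed

end
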